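(* Let $K\subset L$ be a field extension in which every algebraic element of $L$ is separable over $K$. Let $A,B\subset L$ be two non-zero $n$-dimensional $K$-subspaces with $1\notin B$. If $A$ is locally matched to $B$, then $A$ is matched to $B$.
   Context: Let $K\subset L$ be a field extension and $A,B$ two $n$-dimensional $K$-subspaces of $L$. A basis $\{a_1,\ldots,a_n\}$ of $A$ is matched to a basis $\{b_1,\ldots,b_n\}$ of $B$ if for all $b\in B$ and all $i$: $a_ib\in A$ implies $b$ lies in the $K$-span of $\{b_1,\ldots,b_n\}\setminus\{b_i\}$. $A$ is matched to $B$ if every basis of $A$ can be matched to some basis of $B$. For non-zero $m$-dimensional $K$-subspaces $\tilde A\subseteq A$ and $\tilde B\subseteq B$, $\tilde A$ is $A$-matched to $\tilde B$ if for every basis $\{a_1,\ldots,a_m\}$ of $\tilde A$ there is a basis $\{b_1,\ldots,b_m\}$ of $\tilde B$ with $a_ib_i\notin A$ for $i=1,\ldots,m$. $A$ is locally matched to $B$ if for every intermediate field $H$ with $K\subset H\subsetneq L$ such that $H\cap B\neq\{0\}$ and $aH\subseteq A$ for some $a\in A$, there is a $K$-subspace $\tilde A$ of $A$ that is $A$-matched to $H\cap B$. *)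

theory Defs
  imports "HOL-Computational_Algebra.Polynomial"
begin

text \<open>
  A field extension \<open>K \<subseteq> L\<close> is an embedding \<open>\<iota>\<close> of a type \<open>'k\<close> of scalars into a type \<open>'l\<close>; the
  subfield \<open>K\<close> of \<open>L\<close> is \<open>range \<iota>\<close>. Linear algebra over \<open>K\<close> is that of the
  library locale \<^locale>\<open>vector_space\<close> for the scalar multiplication \<open>c \<cdot> x = \<iota> c * x\<close>.
\<close>

locale field_extension =
  fixes \<iota> :: "'k::field \<Rightarrow> 'l::field"
  assumes hom_add: "\<iota> (c + d) = \<iota> c + \<iota> d"
    and hom_mult: "\<iota> (c * d) = \<iota> c * \<iota> d"
    and hom_one: "\<iota> 1 = 1"
begin

sublocale vector_space "\<lambda>c x. \<iota> c * x"
  by unfold_locales (simp_all add: hom_add hom_mult hom_one algebra_simps)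

definition algebraic_over :: "'l \<Rightarrow> bool" where
  "algebraic_over x \<longleftrightarrow> (\<exists>p. p \<noteq> 0 \<and> poly (map_poly \<iota> p) x = 0)"

definition is_min_poly :: "'k poly \<Rightarrow> 'l \<Rightarrow> bool" where
  "is_min_poly p x \<longleftrightarrow> lead_coeff p = 1 \<and> poly (map_poly \<iota> p) x = 0 \<and>
     (\<forall>q. q \<noteq> 0 \<and> poly (map_poly \<iota> q) x = 0 \<longrightarrow> degree p \<le> degree q)"

text \<open>A polynomial is separable if it is coprime to its formal derivative.\<close>

definition separable_over :: "'l \<Rightarrow> bool" where
  "separable_over x \<longleftrightarrow> (\<exists>p. is_min_poly p x \<and> coprime p (pderiv p))"

text \<open>The finiteness clause is needed because \<^const>\<open>dim\<close> of an infinite-dimensional space is \<open>0\<close>.\<close>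

definition subspace_of_dim :: "nat \<Rightarrow> 'l set \<Rightarrow> bool" where
  "subspace_of_dim n A \<longleftrightarrow> subspace A \<and> (\<exists>S. finite S \<and> span S = A) \<and> dim A = n"

text \<open>Bases are ordered: the basis vectors are \<open>a 0, \<dots>, a (n - 1)\<close>, and \<open>a\<close> is unconstrained
  at other indices.\<close>

definition is_basis :: "nat \<Rightarrow> (nat \<Rightarrow> 'l) \<Rightarrow> 'l set \<Rightarrow> bool" where
  "is_basis n a A \<longleftrightarrow> inj_on a {..<n} \<and> independent (a ` {..<n}) \<and> span (a ` {..<n}) = A"

definition basis_matched :: "nat \<Rightarrow> 'l set \<Rightarrow> 'l set \<Rightarrow> (nat \<Rightarrow> 'l) \<Rightarrow> (nat \<Rightarrow> 'l) \<Rightarrow> bool" where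
  "basis_matched n A B a b \<longleftrightarrow>
     (\<forall>\<beta>\<in>B. \<forall>i<n. a i * \<beta> \<in> A \<longrightarrow> \<beta> \<in> span (b ` {..<n} - {b i}))"

definition matched :: "'l set \<Rightarrow> 'l set \<Rightarrow> bool" where
  "matched A B \<longleftrightarrow>
     (\<forall>n a. is_basis n a A \<longrightarrow> (\<exists>b. is_basis n b B \<and> basis_matched n A B a b))"

text \<open>\<open>rel_matched A A' B'\<close>: the subspace \<open>A'\<close> of \<open>A\<close> is \<open>A\<close>-matched to \<open>B'\<close>.\<close>

definition rel_matched :: "'l set \<Rightarrow> 'l set \<Rightarrow> 'l set \<Rightarrow> bool" where
  "rel_matched A A' B' \<longleftrightarrow> A' \<subseteq> A \<and>
     (\<exists>m>0. subspace_of_dim m A' \<and> subspace_of_dim m B' \<and>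
       (\<forall>a. is_basis m a A' \<longrightarrow> (\<exists>b. is_basis m b B' \<and> (\<forall>i<m. a i * b i \<notin> A))))"

definition intermediate_field :: "'l set \<Rightarrow> bool" where
  "intermediate_field H \<longleftrightarrow> range \<iota> \<subseteq> H \<and>
     (\<forall>x\<in>H. \<forall>y\<in>H. x + y \<in> H \<and> x * y \<in> H) \<and> (\<forall>x\<in>H. - x \<in> H \<and> inverse x \<in> H)"

text \<open>In the condition that \<open>a H \<subseteq> A\<close> for some \<open>a \<in> A\<close>, the element \<open>a\<close> is meant to be
  nonzero; for \<open>a = 0\<close> the condition would be void.\<close>

definition locally_matched :: "'l set \<Rightarrow> 'l set \<Rightarrow> bool" where
  "locally_matched A B \<longleftrightarrow>
     (\<forall>H. intermediate_field H \<and> H \<noteq> UNIV \<and> H \<inter> B \<noteq> {0} \<and>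
          (\<exists>a\<in>A. a \<noteq> 0 \<and> (*) a ` H \<subseteq> A) \<longrightarrow>
        (\<exists>A'. rel_matched A A' (H \<inter> B)))"

end

end

theory Submission
  imports Defs
begin

text \<open>
  A basis \<open>a\<close> of \<open>A\<close> can be matched to a basis of \<open>B\<close> as soon as the spaces
  \<open>V i = {\<beta> \<in> B. a i * \<beta> \<in> A}\<close> satisfy the dual Rado condition
  \<open>dim (\<Inter>i\<in>J. V i) + |J| \<le> n\<close> for all \<open>J\<close>. If the condition fails for \<open>J\<close>, then \<open>S\<close>, the span of the
  \<open>a i\<close> with \<open>i \<in> J\<close>, and \<open>U = (\<Inter>i\<in>J. V i)\<close> satisfy \<open>S, SU \<subseteq> A\<close>, \<open>U \<subseteq> B\<close> and \<open>dim S + dim U > n\<close>.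
  Dyson transforms \<open>(S, U) \<mapsto> (S + eU, U \<inter> e\<^sup>-\<^sup>1S)\<close> with \<open>e \<in> S\<close> keep these properties and lead to
  \<open>SU \<subseteq> S\<close>. Then the stabilizer \<open>H\<close> of \<open>S\<close> is a field containing \<open>U\<close>, and a subspace \<open>A'\<close> that is
  \<open>A\<close>-matched to \<open>H \<inter> B\<close> meets \<open>S\<close> trivially because \<open>SH \<subseteq> A\<close>. Hence
  \<open>n \<ge> dim S + dim (H \<inter> B) \<ge> dim S + dim U > n\<close>, a contradiction.
\<close>

section \<open>Finite-dimensional subspaces of an arbitrary vector space\<close>

text \<open>Definitions made in \<^locale>\<open>vector_space\<close> itself would be shadowed by their instances for
  the global interpretation of that locale by real vector spaces.\<close>

locale scalar_space = vector_space
begin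

text \<open>Mere containment in the span of a finite set passes to all subsets. The predicate guards
  dimension arguments, since \<open>dim\<close> is 0 on infinite-dimensional spaces.\<close>

definition fin_dim :: "'b set \<Rightarrow> bool" where
  "fin_dim V \<longleftrightarrow> (\<exists>F. finite F \<and> V \<subseteq> span F)"

lemma fin_dim_subset: "fin_dim W \<Longrightarrow> V \<subseteq> W \<Longrightarrow> fin_dim V"
  unfolding fin_dim_def by blast

lemma fin_dim_insert: "fin_dim W \<Longrightarrow> fin_dim (insert x W)"
proof -
  assume "fin_dim W"
  then obtain F where "finite F" "W \<subseteq> span F" unfolding fin_dim_def by blast
  then have "finite (insert x F)" "insert x W \<subseteq> span (insert x F)"
    using span_mono[of F "insert x F"] span_base[of x "insert x F"] by auto
  then show ?thesis unfolding fin_dim_def by blast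
qed

lemma fin_dim_independent_finite:
  assumes "fin_dim W" "independent C" "C \<subseteq> W"
  shows "finite C"
  using assms independent_span_bound unfolding fin_dim_def by blast

lemma fin_dim_extend_basis:
  assumes "fin_dim W" "subspace W" "C \<subseteq> W" "independent C"
  obtains D where "C \<subseteq> D" "finite D" "independent D" "span D = W" "card D = dim W"
proof -
  obtain D where D: "C \<subseteq> D" "D \<subseteq> W" "independent D" "W \<subseteq> span D"
    using maximal_independent_subset_extend[of C W] assms by blast
  moreover have "finite D" using fin_dim_independent_finite assms D by blast
  moreover have "span D = W" using D assms(2) by (simp add: span_minimal subset_antisym)
  moreover have "card D = dim W" using D basis_card_eq_dim by blast
  ultimately show ?thesis using that by blast
qed

lemma fin_dim_dim_mono:
  assumes "fin_dim W" "V \<subseteq> W"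
  shows "dim V \<le> dim W"
proof -
  obtain C where C: "C \<subseteq> W" "independent C" "W \<subseteq> span C" "card C = dim W"
    using basis_exists by blast
  then have "finite C" using fin_dim_independent_finite assms(1) by blast
  then show ?thesis using dim_le_card[of V C] C assms(2) by auto
qed

lemma fin_dim_dim_insert:
  assumes "fin_dim W" "x \<notin> span W"
  shows "dim (insert x W) = Suc (dim W)"
proof -
  obtain C where C: "C \<subseteq> W" "independent C" "W \<subseteq> span C" "card C = dim W"
    using basis_exists by blast
  have fin: "finite C" using C fin_dim_independent_finite assms(1) by blast
  have eq: "span C = span W"
    using C by (metis span_mono span_minimal subspace_span subset_antisym)
  have "independent (insert x C)"
    using C(2) assms(2) eq independent_insertI by simp
  moreover have "insert x W \<subseteq> span (insert x C)"
    using C(3) span_mono[of C "insert x C"] span_base[of x "insert x C"] by auto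
  moreover have "card (insert x C) = Suc (dim W)"
    using C(4) fin assms(2) eq span_base[of x C] card_insert_disjoint[OF fin] by metis
  ultimately show ?thesis
    using dim_unique[of "insert x C" "insert x W"] C(1) by auto
qed

lemma fin_dim_subspace_eq:
  assumes "fin_dim W" "subspace V" "V \<subseteq> W" "dim W \<le> dim V"
  shows "V = W"
proof (rule ccontr)
  assume "V \<noteq> W"
  then obtain x where x: "x \<in> W" "x \<notin> V" using assms(3) by blast
  have "dim (insert x V) = Suc (dim V)"
    using fin_dim_dim_insert fin_dim_subset assms x span_eq_iff by metis
  moreover have "dim (insert x V) \<le> dim W"
    using fin_dim_dim_mono[OF assms(1)] x assms(3) by simp
  ultimately show False using assms(4) by simp
qed

lemma subspace_nonzero_element:
  assumes "subspace V" "dim V > 0"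
  obtains x where "x \<in> V" "x \<noteq> 0"
proof -
  have "dim {0} = 0" using dim_le_card[of "{0}" "{}"] by simp
  then have "V \<noteq> {0}" using assms by auto
  then show ?thesis using that subspace_0[OF assms(1)] by blast
qed

lemma fin_dim_dim_eq_0:
  assumes "fin_dim V" "dim V = 0"
  shows "V \<subseteq> {0}"
proof -
  obtain C where "C \<subseteq> V" "independent C" "V \<subseteq> span C" "card C = dim V"
    using basis_exists by blast
  moreover from this have "finite C" using fin_dim_independent_finite assms(1) by blast
  ultimately show ?thesis using assms(2) by simp
qed

text \<open>A basis \<open>C\<close> of \<open>S \<inter> T\<close> extends to a basis
  \<open>D\<close> of \<open>S\<close>. The sum is spanned by \<open>T\<close> and
  \<open>D - C\<close>, and \<open>D - C\<close> has \<open>dim S - dim (S \<inter> T)\<close>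
  elements.\<close>

lemma fin_dim_dim_sums_Int:
  assumes S: "subspace S" "fin_dim S" and T: "subspace T" "fin_dim T"
  shows "dim {x + y |x y. x \<in> S \<and> y \<in> T} + dim (S \<inter> T) = dim S + dim T"
proof -
  have I: "subspace (S \<inter> T)" using S T subspace_inter by blast
  have "{} \<subseteq> S \<inter> T" "independent {}" by (simp_all add: dependent_def)
  from fin_dim_extend_basis[OF fin_dim_subset[OF S(2) Int_lower1] I this]
  obtain C where C: "finite C" "independent C" "span C = S \<inter> T" "card C = dim (S \<inter> T)"
    by metis
  have "C \<subseteq> S" using C span_superset[of C] by blast
  then obtain D where D: "C \<subseteq> D" "finite D" "independent D" "span D = S" "card D = dim S"
    using fin_dim_extend_basis[OF S(2,1) _ C(2)] by metis
  have sT: "span T = T" using T(1) by (simp only: span_eq_iff)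
  \<comment> \<open>Every vector of \<open>D - C\<close> raises the dimension by one when it is added to \<open>T\<close>.\<close>
  have step: "E \<subseteq> D - C \<Longrightarrow> fin_dim (E \<union> T) \<and> dim (E \<union> T) = card E + dim T"
    if "finite E" for E
    using that
  proof (induction E rule: finite_induct)
    case empty
    then show ?case using T by simp
  next
    case (insert x E)
    have IH: "fin_dim (E \<union> T)" "dim (E \<union> T) = card E + dim T" using insert by auto
    \<comment> \<open>Writing \<open>x = s + t\<close> puts \<open>t\<close> into
      \<open>S \<inter> T = span C\<close>, so \<open>x\<close> would depend on other members of the
      basis \<open>D\<close>.\<close>
    have "x \<notin> span (E \<union> T)"
    proof
      assume "x \<in> span (E \<union> T)"
      then obtain s t where st: "x = s + t" "s \<in> span E" "t \<in> T"
        unfolding span_Un sT by auto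
      have "s \<in> S" using st(2) insert.prems D(4) span_mono[of E D] by blast
      moreover have "x \<in> S" using insert.prems D(4) span_base by blast
      ultimately have "t \<in> S" using subspace_diff[OF S(1), of x s] st(1) by simp
      then have "t \<in> span C" using st C by blast
      then have "x \<in> span (E \<union> C)" using st unfolding span_Un by blast
      moreover have "E \<union> C \<subseteq> D - {x}" using insert D(1) by blast
      ultimately have "x \<in> span (D - {x})" using span_mono by blast
      then show False using D(3) insert.prems unfolding dependent_def by blast
    qed
    then show ?case
      using IH insert.hyps fin_dim_dim_insert[OF IH(1)] fin_dim_insert[OF IH(1)] by simp
  qed
  have sums: "{x + y |x y. x \<in> S \<and> y \<in> T} = span ((D - C) \<union> T)"
  proof -
    have "D \<union> T \<subseteq> span ((D - C) \<union> T)"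
    proof
      fix x assume "x \<in> D \<union> T"
      moreover have "x \<in> T" if "x \<in> C" using that C(3) span_base by blast
      ultimately have "x \<in> (D - C) \<union> T" by blast
      then show "x \<in> span ((D - C) \<union> T)" by (rule span_base)
    qed
    then have "span (D \<union> T) = span ((D - C) \<union> T)"
      by (metis Diff_subset Un_mono order_refl span_mono span_minimal subspace_span subset_antisym)
    moreover have "span (D \<union> T) = {x + y |x y. x \<in> S \<and> y \<in> T}"
      unfolding span_Un sT D(4) by auto
    ultimately show ?thesis by simp
  qed
  have fin: "finite (D - C)" using D by simp
  have "card (D - C) = dim S - dim (S \<inter> T)" "dim (S \<inter> T) \<le> dim S"
    using C D card_Diff_subset card_mono by metis+
  then show ?thesis
    unfolding sums using step[OF fin] by simp
qed

lemma fin_dim_dim_Int_ge: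
  assumes W: "fin_dim W" "subspace W" and "subspace S" "S \<subseteq> W" "subspace T" "T \<subseteq> W"
  shows "dim S + dim T \<le> dim W + dim (S \<inter> T)"
proof -
  have "{x + y |x y. x \<in> S \<and> y \<in> T} \<subseteq> W"
    using assms by (auto intro: subspace_add)
  then have "dim {x + y |x y. x \<in> S \<and> y \<in> T} \<le> dim W"
    by (rule fin_dim_dim_mono[OF W(1)])
  then show ?thesis using fin_dim_dim_sums_Int[of S T] assms fin_dim_subset by fastforce
qed

section \<open>A dual form of Rado's theorem\<close>

text \<open>For subspaces \<open>V i\<close> of \<open>B\<close> with \<open>dim B = n\<close>,
  passing to annihilators in the dual of \<open>B\<close> turns intersections into sums and gives
  Rado's condition for an independent transversal. Intersecting with \<open>B\<close> makes the
  empty \<open>J\<close> yield \<open>B\<close> instead of the whole space.\<close>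

definition rado_condition :: "'b set \<Rightarrow> nat \<Rightarrow> (nat \<Rightarrow> 'b set) \<Rightarrow> bool" where
  "rado_condition B n V \<longleftrightarrow> (\<forall>J\<subseteq>{..<n}. dim (B \<inter> \<Inter>(V ` J)) + card J \<le> n)"

lemma subspace_Int_Inter:
  assumes "subspace B" "\<And>i. i \<in> J \<Longrightarrow> subspace (V i)"
  shows "subspace (B \<inter> \<Inter>(V ` J))"
  using assms by (auto intro!: subspace_inter subspace_Inter)

text \<open>Here the condition at singletons makes every \<open>V i\<close> a hyperplane of
  \<open>B\<close>. Any \<open>n - 1\<close> of them share a nonzero vector and all \<open>n\<close>
  share only 0, so \<open>b\<close> is, up to scaling, the basis dual to the functionals with
  kernels \<open>V i\<close>.\<close>

lemma rado_condition_hyperplanes: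
  assumes B: "fin_dim B" "subspace B" "dim B = n"
    and V: "\<And>i. i < n \<Longrightarrow> subspace (V i) \<and> V i \<subseteq> B"
    and rado: "rado_condition B n V"
    and big: "\<And>i. i < n \<Longrightarrow> n \<le> dim (V i) + 1"
  shows "\<exists>b. inj_on b {..<n} \<and> independent (b ` {..<n}) \<and> span (b ` {..<n}) = B \<and>
    (\<forall>i<n. V i \<subseteq> span (b ` {..<n} - {b i}))"
proof -
  \<comment> \<open>Each further \<open>V j\<close> has codimension at most one in \<open>B\<close>
    and so costs the intersection at most one dimension.\<close>
  have ge: "n \<le> dim (B \<inter> \<Inter>(V ` J)) + card J" if "finite J" "J \<subseteq> {..<n}" for J
    using that
  proof (induction J rule: finite_induct)
    case empty
    then show ?case using B by simp
  next
    case (insert j J)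
    have "subspace (B \<inter> \<Inter>(V ` J))" using B V insert.prems by (intro subspace_Int_Inter) auto
    then have "dim (B \<inter> \<Inter>(V ` J)) + dim (V j) \<le> n + dim (B \<inter> \<Inter>(V ` J) \<inter> V j)"
      using fin_dim_dim_Int_ge[OF B(1,2)] B(3) V insert.prems by auto
    moreover have "B \<inter> \<Inter>(V ` J) \<inter> V j = B \<inter> \<Inter>(V ` insert j J)" by auto
    moreover have "n \<le> dim (V j) + 1" using big insert.prems by simp
    ultimately show ?case using insert by simp
  qed
  have "\<exists>x. x \<in> B \<inter> \<Inter>(V ` ({..<n} - {i})) \<and> x \<noteq> 0" if "i \<in> {..<n}" for i
  proof -
    have "n \<le> dim (B \<inter> \<Inter>(V ` ({..<n} - {i}))) + (n - 1)" using ge[of "{..<n} - {i}"] that by auto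
    then have pos: "dim (B \<inter> \<Inter>(V ` ({..<n} - {i}))) > 0" using that by simp
    have "subspace (B \<inter> \<Inter>(V ` ({..<n} - {i})))"
      using B V by (intro subspace_Int_Inter) auto
    then obtain x where "x \<in> B \<inter> \<Inter>(V ` ({..<n} - {i}))" "x \<noteq> 0"
      using pos by (rule subspace_nonzero_element)
    then show ?thesis by blast
  qed
  then obtain b where "\<forall>i\<in>{..<n}. b i \<in> B \<inter> \<Inter>(V ` ({..<n} - {i})) \<and> b i \<noteq> 0"
    using bchoice[of "{..<n}"] by meson
  then have b: "b i \<in> B \<inter> \<Inter>(V ` ({..<n} - {i})) \<and> b i \<noteq> 0" if "i < n" for i
    using that by simp
  have "dim (B \<inter> \<Inter>(V ` {..<n})) + card {..<n} \<le> n"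
    using rado unfolding rado_condition_def by blast
  then have "dim (B \<inter> \<Inter>(V ` {..<n})) = 0" by simp
  then have all: "B \<inter> \<Inter>(V ` {..<n}) \<subseteq> {0}"
    by (rule fin_dim_dim_eq_0[OF fin_dim_subset[OF B(1) Int_lower1]])
  have out: "b i \<notin> V i" if "i < n" for i
  proof
    assume "b i \<in> V i"
    then have "b i \<in> B \<inter> \<Inter>(V ` {..<n})" using b[OF that] by auto
    then show False using all b[OF that] by blast
  qed
  have inj: "inj_on b {..<n}"
  proof (rule inj_onI)
    fix i j assume ij: "i \<in> {..<n}" "j \<in> {..<n}" "b i = b j"
    show "i = j"
    proof (rule ccontr)
      assume "i \<noteq> j"
      then have "b j \<in> V i" using b[of j] ij by auto
      then show False using out[of i] ij by auto
    qed
  qed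
  \<comment> \<open>All \<open>b j\<close> with \<open>b j \<noteq> b i\<close> lie in
    \<open>V i\<close> while \<open>b i\<close> does not; this gives independence.\<close>
  have sub: "span (b ` {..<n} - {b i}) \<subseteq> V i" if "i < n" for i
    using b that V by (intro span_minimal) fastforce+
  have indep: "independent (b ` {..<n})"
    unfolding dependent_def using sub out by blast
  have bB: "b ` {..<n} \<subseteq> B" using b by auto
  have card: "card (b ` {..<n}) = n" using inj by (simp add: card_image)
  have "span (b ` {..<n}) = B"
    using bB B indep card dim_span_eq_card_independent[OF indep]
    by (intro fin_dim_subspace_eq) (auto simp: span_minimal)
  \<comment> \<open>The span without \<open>b i\<close> has dimension \<open>n - 1\<close> and lies
    in \<open>V i\<close>; the condition at \<open>{i}\<close> bounds \<open>dim (V i)\<close> by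
    \<open>n - 1\<close>, so the two are equal.\<close>
  moreover have "V i \<subseteq> span (b ` {..<n} - {b i})" if "i < n" for i
  proof -
    have "independent (b ` {..<n} - {b i})" using indep independent_mono by blast
    then have "dim (span (b ` {..<n} - {b i})) = n - 1"
      using dim_span_eq_card_independent card that by simp
    moreover have "dim (B \<inter> \<Inter>(V ` {i})) + card {i} \<le> n"
      using rado that unfolding rado_condition_def by blast
    moreover have "B \<inter> \<Inter>(V ` {i}) = V i" using V[OF that] by auto
    ultimately have "span (b ` {..<n} - {b i}) = V i"
      using sub[OF that] V[OF that] fin_dim_subset[OF B(1)]
      by (intro fin_dim_subspace_eq) auto
    then show ?thesis by simp
  qed
  ultimately show ?thesis using inj indep by blast
qed

text \<open>If neither of two proper enlargements of \<open>V i\<close> that meet in \<open>V i\<close> preserves the condition,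
  submodularity of the dimension refutes it for \<open>V\<close> itself.\<close>

lemma rado_condition_enlarge:
  assumes B: "fin_dim B" "subspace B" "dim B = n"
    and V: "\<And>i. i < n \<Longrightarrow> subspace (V i) \<and> V i \<subseteq> B"
    and rado: "rado_condition B n V"
    and i: "i < n" "dim (V i) + 1 < n"
  obtains X where "subspace X" "V i \<subseteq> X" "X \<subseteq> B" "dim (V i) < dim X"
    "rado_condition B n (V(i := X))"
proof -
  have Vi: "subspace (V i)" "V i \<subseteq> B" using V[OF i(1)] by simp_all
  have fVi: "fin_dim (V i)" using fin_dim_subset[OF B(1) Vi(2)] .
  have sVi: "span (V i) = V i" using Vi(1) by (simp only: span_eq_iff)
  have "V i \<noteq> B" using B i by auto
  then obtain u where u: "u \<in> B" "u \<notin> V i" using Vi by blast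
  \<comment> \<open>Since \<open>V i\<close> has codimension at least two in \<open>B\<close>, there
    is room for \<open>u\<close> outside \<open>V i\<close> and then \<open>v\<close> outside
    \<open>X\<close>. Adjoining one vector at a time yields \<open>X\<close> and \<open>Y\<close>
    with \<open>X \<inter> Y = V i\<close>.\<close>
  define X where "X = span (insert u (V i))"
  have dX: "dim X = Suc (dim (V i))"
    unfolding X_def using fin_dim_dim_insert[OF fVi] u by (simp add: sVi)
  have XB: "X \<subseteq> B" unfolding X_def using u Vi B by (intro span_minimal) auto
  have "X \<noteq> B" using B i dX by auto
  then obtain v where v: "v \<in> B" "v \<notin> X" using XB by blast
  have VX: "V i \<subseteq> X" unfolding X_def using span_superset by blast
  define Y where "Y = span (insert v (V i))"
  have YB: "Y \<subseteq> B" unfolding Y_def using v Vi B by (intro span_minimal) auto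
  have VY: "V i \<subseteq> Y" unfolding Y_def using span_superset by blast
  have dY: "dim Y = Suc (dim (V i))"
    unfolding Y_def using fin_dim_dim_insert[OF fVi] v VX by (auto simp: sVi)
  have sXY: "subspace X" "subspace Y" unfolding X_def Y_def by simp_all
  have XY: "X \<inter> Y = V i"
  proof
    show "X \<inter> Y \<subseteq> V i"
    proof
      fix z assume z: "z \<in> X \<inter> Y"
      then obtain k where k: "z - scale k v \<in> V i"
        unfolding Y_def by (auto simp: span_breakdown_eq sVi)
      then have "z - (z - scale k v) \<in> X" using z VX subspace_diff[OF sXY(1)] by blast
      then have "scale k v \<in> X" by simp
      then have "scale (inverse k) (scale k v) \<in> X" using subspace_scale[OF sXY(1)] by blast
      then have "k = 0" using v(2) by (cases "k = 0") auto
      then show "z \<in> V i" using k by simp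
    qed
  qed (use VX VY in auto)
  \<comment> \<open>A violating index set must contain \<open>i\<close>, because the others do not
    see the change at \<open>i\<close>. Removing \<open>i\<close> from it turns the strict
    inequality into a weak one.\<close>
  have fail: "\<exists>J\<subseteq>{..<n} - {i}. n \<le> dim (Z \<inter> \<Inter>(V ` J)) + card J"
    if Z: "Z \<subseteq> B" "\<not> rado_condition B n (V(i := Z))" for Z
  proof -
    obtain J where J: "J \<subseteq> {..<n}" "dim (B \<inter> \<Inter>((V(i := Z)) ` J)) + card J > n"
      using Z(2) unfolding rado_condition_def not_all not_imp not_le by blast
    have "i \<in> J"
    proof (rule ccontr)
      assume "i \<notin> J"
      then have "(V(i := Z)) ` J = V ` J" by (intro image_cong) auto
      moreover have "dim (B \<inter> \<Inter>(V ` J)) + card J \<le> n"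
        using J(1) rado unfolding rado_condition_def by blast
      ultimately show False using J(2) by simp
    qed
    have "(V(i := Z)) ` (J - {i}) = V ` (J - {i})" by (intro image_cong) auto
    moreover have "J = insert i (J - {i})" using \<open>i \<in> J\<close> by blast
    ultimately have "(V(i := Z)) ` J = insert Z (V ` (J - {i}))"
      by (metis fun_upd_same image_insert)
    then have "B \<inter> \<Inter>((V(i := Z)) ` J) = Z \<inter> \<Inter>(V ` (J - {i}))"
      using Z(1) by auto
    moreover have "card J = Suc (card (J - {i}))"
      using card.remove[OF finite_subset[OF J(1) finite_lessThan] \<open>i \<in> J\<close>] .
    ultimately have "n \<le> dim (Z \<inter> \<Inter>(V ` (J - {i}))) + card (J - {i})" using J by simp
    moreover have "J - {i} \<subseteq> {..<n} - {i}" using J by blast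
    ultimately show ?thesis by blast
  qed
  have "rado_condition B n (V(i := X)) \<or> rado_condition B n (V(i := Y))"
  proof (rule ccontr)
    assume "\<not> ?thesis"
    then obtain J K where J: "J \<subseteq> {..<n} - {i}" "n \<le> dim (X \<inter> \<Inter>(V ` J)) + card J"
      and K: "K \<subseteq> {..<n} - {i}" "n \<le> dim (Y \<inter> \<Inter>(V ` K)) + card K"
      using fail XB YB by meson
    \<comment> \<open>Adding the two failures gives \<open>2 * n\<close> as a lower bound for
      \<open>dim ?P + dim ?Q + card J + card K\<close>. The condition for \<open>V\<close> at
      \<open>J \<inter> K\<close> and at \<open>insert i (J \<union> K)\<close> bounds the same
      quantity by \<open>n + (n - 1)\<close>.\<close>
    let ?P = "X \<inter> \<Inter>(V ` J)" and ?Q = "Y \<inter> \<Inter>(V ` K)" and ?R = "B \<inter> \<Inter>(V ` (J \<inter> K))"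
    have "dim ?P + dim ?Q \<le> dim ?R + dim (?P \<inter> ?Q)"
    proof (rule fin_dim_dim_Int_ge)
      show "fin_dim ?R" by (rule fin_dim_subset[OF B(1) Int_lower1])
      show "subspace ?R" using B V J by (intro subspace_Int_Inter) auto
      show "subspace ?P" using sXY V J by (intro subspace_Int_Inter) auto
      show "subspace ?Q" using sXY V K by (intro subspace_Int_Inter) auto
    qed (use XB YB in auto)
    moreover have "dim ?R + card (J \<inter> K) \<le> n"
      using rado J unfolding rado_condition_def by blast
    moreover have "dim (?P \<inter> ?Q) + Suc (card (J \<union> K)) \<le> n"
    proof -
      have fin: "finite (J \<union> K)" using J K finite_subset by blast
      have "?P \<inter> ?Q = B \<inter> \<Inter>(V ` insert i (J \<union> K))" using XY Vi(2) by auto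
      moreover have "card (insert i (J \<union> K)) = Suc (card (J \<union> K))"
        using fin J K by (subst card_insert_disjoint) auto
      moreover have "insert i (J \<union> K) \<subseteq> {..<n}" using J K i by auto
      then have "dim (B \<inter> \<Inter>(V ` insert i (J \<union> K))) + card (insert i (J \<union> K)) \<le> n"
        using rado unfolding rado_condition_def by blast
      ultimately show ?thesis by simp
    qed
    moreover have "card J + card K = card (J \<union> K) + card (J \<inter> K)"
      using J K by (intro card_Un_Int) (auto intro: finite_subset)
    ultimately show False using J K by linarith
  qed
  then show ?thesis using that VX VY XB YB dX dY sXY by auto
qed

text \<open>Induction on the total codimension of the \<open>V i\<close>. Enlarging one of them only
  strengthens the conclusion, so enlargement can continue until all are hyperplanes.\<close>

theorem dual_rado:
  assumes B: "fin_dim B" "subspace B" "dim B = n"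
    and V: "\<And>i. i < n \<Longrightarrow> subspace (V i) \<and> V i \<subseteq> B"
    and rado: "rado_condition B n V"
  shows "\<exists>b. inj_on b {..<n} \<and> independent (b ` {..<n}) \<and> span (b ` {..<n}) = B \<and>
    (\<forall>i<n. V i \<subseteq> span (b ` {..<n} - {b i}))"
  using V rado
proof (induction "\<Sum>i<n. n - dim (V i)" arbitrary: V rule: less_induct)
  case less
  show ?case
  proof (cases "\<forall>i<n. n \<le> dim (V i) + 1")
    case True
    then show ?thesis using rado_condition_hyperplanes[OF B less.prems] by blast
  next
    case False
    then obtain i where i: "i < n" "dim (V i) + 1 < n" by force
    obtain X where X: "subspace X" "V i \<subseteq> X" "X \<subseteq> B" "dim (V i) < dim X"
        "rado_condition B n (V(i := X))"
      using rado_condition_enlarge[OF B less.prems i] by blast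
    let ?W = "V(i := X)"
    have "(\<Sum>j<n. n - dim (?W j)) < (\<Sum>j<n. n - dim (V j))"
    proof (rule sum_strict_mono_ex1)
      \<comment> \<open>As \<open>dim (V i) < n\<close>, truncated subtraction does not hide the
        decrease at \<open>i\<close>.\<close>
      show "\<exists>j\<in>{..<n}. n - dim (?W j) < n - dim (V j)"
        using i X by (intro bexI[of _ i]) auto
    qed (use X in auto)
    moreover have "subspace (?W j) \<and> ?W j \<subseteq> B" if "j < n" for j
      using less.prems(1)[OF that] X by auto
    ultimately obtain b where b: "inj_on b {..<n}" "independent (b ` {..<n})" "span (b ` {..<n}) = B"
      "\<forall>j<n. ?W j \<subseteq> span (b ` {..<n} - {b j})"
      using less.hyps X(5) by blast
    have "V j \<subseteq> ?W j" for j using X by auto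
    then show ?thesis using b by blast
  qed
qed

end

section \<open>Dyson transforms and stabilizers\<close>

context field_extension
begin

sublocale scalar_space "\<lambda>c x. \<iota> c * x" ..

lemma subspace_of_dim_fin_dim:
  "subspace_of_dim n V \<Longrightarrow> subspace V \<and> fin_dim V \<and> dim V = n"
  unfolding subspace_of_dim_def fin_dim_def by auto

lemma subspace_mult_image:
  assumes "subspace U"
  shows "subspace ((*) e ` U)"
proof (rule subspaceI)
  show "0 \<in> (*) e ` U" using subspace_0[OF assms] by (intro image_eqI[of _ _ 0]) auto
next
  fix x y assume "x \<in> (*) e ` U" "y \<in> (*) e ` U"
  then obtain u v where uv: "u \<in> U" "v \<in> U" "x = e * u" "y = e * v" by blast
  then show "x + y \<in> (*) e ` U"
    using subspace_add[OF assms, of u v] by (intro image_eqI[of _ _ "u + v"]) (auto simp: algebra_simps)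
next
  fix c x assume "x \<in> (*) e ` U"
  then obtain u where u: "u \<in> U" "x = e * u" by blast
  then show "\<iota> c * x \<in> (*) e ` U"
    using subspace_scale[OF assms, of u c]
    by (intro image_eqI[of _ _ "\<iota> c * u"]) (auto simp: algebra_simps)
qed

text \<open>Multiplication by any element carries spanning sets to spanning sets, so it cannot raise
  the dimension; applying this to \<open>inverse e\<close> as well gives equality.\<close>

lemma dim_mult_image:
  assumes "e \<noteq> 0" "fin_dim U"
  shows "fin_dim ((*) e ` U)" "dim ((*) e ` U) = dim U"
proof -
  have le: "fin_dim ((*) d ` W) \<and> dim ((*) d ` W) \<le> dim W" if W: "fin_dim W" for d W
  proof -
    obtain C where C: "C \<subseteq> W" "independent C" "W \<subseteq> span C" "card C = dim W"
      using basis_exists by blast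
    have fin: "finite C" using C fin_dim_independent_finite W by blast
    have "subspace {x. d * x \<in> span ((*) d ` C)}"
    proof (rule subspaceI)
      fix x y assume "x \<in> {x. d * x \<in> span ((*) d ` C)}" "y \<in> {x. d * x \<in> span ((*) d ` C)}"
      then show "x + y \<in> {x. d * x \<in> span ((*) d ` C)}"
        using span_add[of "d * x" "(*) d ` C" "d * y"] by (simp add: algebra_simps)
    next
      fix c x assume "x \<in> {x. d * x \<in> span ((*) d ` C)}"
      then show "\<iota> c * x \<in> {x. d * x \<in> span ((*) d ` C)}"
        using span_scale[of "d * x" "(*) d ` C" c] by (simp add: algebra_simps)
    qed (simp add: span_zero)
    then have "span C \<subseteq> {x. d * x \<in> span ((*) d ` C)}"
      by (intro span_minimal) (auto intro: span_base)
    then have sub: "(*) d ` W \<subseteq> span ((*) d ` C)" using C(3) by blast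
    then have "fin_dim ((*) d ` W)" using fin unfolding fin_dim_def by blast
    moreover have "dim ((*) d ` W) \<le> card ((*) d ` C)" using sub fin dim_le_card by blast
    then have "dim ((*) d ` W) \<le> dim W" using C(4) card_image_le[OF fin, of "(*) d"] by linarith
    ultimately show ?thesis by blast
  qed
  show fin: "fin_dim ((*) e ` U)" using le assms by blast
  have "(*) (inverse e) ` (*) e ` U = U"
    using assms(1) by (simp add: image_image mult.assoc[symmetric])
  then have "dim U \<le> dim ((*) e ` U)" using le[OF fin, of "inverse e"] by simp
  then show "dim ((*) e ` U) = dim U" using le[OF assms(2), of e] by simp
qed

text \<open>While some \<open>e * u\<close> with \<open>e \<in> S\<close> and
  \<open>u \<in> U\<close> leaves \<open>S\<close>, the transform at \<open>e\<close> strictly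
  enlarges \<open>S\<close> inside \<open>A\<close>. Hence the induction on
  \<open>dim A - dim S\<close>.\<close>

lemma dyson_transform:
  assumes A: "fin_dim A" "subspace A"
    and "subspace S" "S \<subseteq> A" "subspace U" "fin_dim U"
    and "\<And>s u. s \<in> S \<Longrightarrow> u \<in> U \<Longrightarrow> s * u \<in> A"
  obtains T W where "subspace T" "S \<subseteq> T" "T \<subseteq> A" "subspace W" "W \<subseteq> U"
    "dim T + dim W = dim S + dim U" "\<And>t w. t \<in> T \<Longrightarrow> w \<in> W \<Longrightarrow> t * w \<in> T"
proof -
  have "\<exists>T W. subspace T \<and> S \<subseteq> T \<and> T \<subseteq> A \<and> subspace W \<and> W \<subseteq> U \<and>
      dim T + dim W = dim S + dim U \<and> (\<forall>t\<in>T. \<forall>w\<in>W. t * w \<in> T)"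
    using assms(3-)
  proof (induction "dim A - dim S" arbitrary: S U rule: less_induct)
    case less
    note S = less.prems(1,2) and U = less.prems(3,4) and SU = less.prems(5)
    show ?case
    proof (cases "\<forall>s\<in>S. \<forall>u\<in>U. s * u \<in> S")
      case True
      then show ?thesis using S U by blast
    next
      case False
      then obtain e u where eu: "e \<in> S" "u \<in> U" "e * u \<notin> S" by blast
      then have e0: "e \<noteq> 0" using subspace_0[OF S(1)] by auto
      let ?eU = "(*) e ` U"
      define S1 where "S1 = {x + y |x y. x \<in> S \<and> y \<in> ?eU}"
      define U1 where "U1 = {u \<in> U. e * u \<in> S}"
      have eU: "subspace ?eU" "fin_dim ?eU" "dim ?eU = dim U"
        using subspace_mult_image[OF U(1)] dim_mult_image[OF e0 U(2)] by auto
      have fS: "fin_dim S" by (rule fin_dim_subset[OF A(1) S(2)])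
      have S1: "subspace S1" unfolding S1_def by (rule subspace_sums[OF S(1) eU(1)])
      have sub: "S \<subseteq> S1"
        unfolding S1_def using subspace_0[OF eU(1)] by force
      have "e * u \<in> S1"
        unfolding S1_def using subspace_0[OF S(1)] eu by force
      then have "S \<noteq> S1" using eu by blast
      have S1A: "S1 \<subseteq> A"
        unfolding S1_def using S SU eu by (auto intro!: subspace_add[OF A(2)])
      have fS1: "fin_dim S1" by (rule fin_dim_subset[OF A(1) S1A])
      have lt: "dim S < dim S1"
        using fin_dim_subspace_eq[OF fS1 S(1) sub] \<open>S \<noteq> S1\<close> by force
      have U1: "subspace U1"
      proof (rule subspaceI)
        show "0 \<in> U1" unfolding U1_def using subspace_0 S U by simp
      next
        fix x y assume "x \<in> U1" "y \<in> U1"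
        then show "x + y \<in> U1"
          unfolding U1_def using subspace_add[OF U(1)] subspace_add[OF S(1)]
          by (simp add: distrib_left)
      next
        fix c x assume "x \<in> U1"
        then show "\<iota> c * x \<in> U1"
          unfolding U1_def using subspace_scale[OF U(1)] subspace_scale[OF S(1), of "e * x" c]
          by (simp add: mult.left_commute)
      qed
      have U1U: "U1 \<subseteq> U" unfolding U1_def by blast
      have fU1: "fin_dim U1" by (rule fin_dim_subset[OF U(2) U1U])
      \<comment> \<open>The overlap in the sum \<open>S + eU\<close> is \<open>e * U1\<close>, so
        \<open>S\<close> gains exactly the dimension that \<open>U\<close> loses.\<close>
      have "S \<inter> ?eU = (*) e ` U1" unfolding U1_def by auto
      then have "dim (S \<inter> ?eU) = dim U1" using dim_mult_image[OF e0 fU1] by simp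
      then have dims: "dim S1 + dim U1 = dim S + dim U"
        using fin_dim_dim_sums_Int[OF S(1) fS eU(1,2)] eU(3) unfolding S1_def by simp
      \<comment> \<open>The definition of \<open>U1\<close> gives \<open>e * w \<in> S\<close>, so
        both summands of \<open>(s + e * v) * w = s * w + (e * w) * v\<close> are products of an
        element of \<open>S\<close> with one of \<open>U\<close>.\<close>
      have prod: "x * w \<in> A" if xw: "x \<in> S1" "w \<in> U1" for x w
      proof -
        obtain s v where sv: "s \<in> S" "v \<in> U" "x = s + e * v" using xw(1) unfolding S1_def by auto
        have "s * w \<in> A" using SU sv xw(2) unfolding U1_def by blast
        moreover have "(e * w) * v \<in> A" using SU sv xw(2) unfolding U1_def by blast
        ultimately show ?thesis
          using subspace_add[OF A(2), of "s * w" "(e * w) * v"] sv by (simp add: algebra_simps)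
      qed
      have "dim S1 \<le> dim A" using fin_dim_dim_mono[OF A(1) S1A] .
      then have "dim A - dim S1 < dim A - dim S" using lt by simp
      from less.hyps[OF this S1 S1A U1 fU1 prod] obtain T W where
        "subspace T" "S1 \<subseteq> T" "T \<subseteq> A" "subspace W" "W \<subseteq> U1"
        "dim T + dim W = dim S1 + dim U1" "\<forall>t\<in>T. \<forall>w\<in>W. t * w \<in> T"
        by blast
      then show ?thesis using sub U1U dims by (intro exI[of _ T] exI[of _ W]) auto
    qed
  qed
  then show ?thesis using that by blast
qed

text \<open>Only inverses need finite dimension: multiplication by a nonzero \<open>h\<close> maps
  \<open>S\<close> into itself and preserves dimension, hence is onto. For \<open>h = 0\<close> the
  inverse is 0 by convention.\<close>

lemma stabilizer_intermediate_field:
  assumes S: "fin_dim S" "subspace S"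
  shows "intermediate_field {h. \<forall>s\<in>S. s * h \<in> S}"
proof -
  have inv: "s * inverse h \<in> S" if h: "\<forall>s\<in>S. s * h \<in> S" and s: "s \<in> S" for h s
  proof (cases "h = 0")
    case True
    then show ?thesis using subspace_0 S by simp
  next
    case False
    have "(*) h ` S \<subseteq> S" using h by (auto simp: mult.commute)
    then have "(*) h ` S = S"
      using fin_dim_subspace_eq[OF S(1)] subspace_mult_image S dim_mult_image[OF False] by simp
    then obtain t where "t \<in> S" "s = h * t" using s by blast
    then show ?thesis using False by (simp add: field_simps)
  qed
  have "s * \<iota> c \<in> S" if "s \<in> S" for s c
    using subspace_scale[OF S(2) that, of c] by (simp add: mult.commute)
  moreover have "s * (x + y) \<in> S"
    if "\<forall>s\<in>S. s * x \<in> S" "\<forall>s\<in>S. s * y \<in> S" "s \<in> S" for s x y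
    using that subspace_add[OF S(2), of "s * x" "s * y"] by (simp add: distrib_left)
  moreover have "s * (x * y) \<in> S"
    if "\<forall>s\<in>S. s * x \<in> S" "\<forall>s\<in>S. s * y \<in> S" "s \<in> S" for s x y
    using that by (simp add: mult.assoc[symmetric])
  moreover have "s * (- x) \<in> S" if "\<forall>s\<in>S. s * x \<in> S" "s \<in> S" for s x
    using that subspace_neg[OF S(2), of "s * x"] by simp
  ultimately show ?thesis unfolding intermediate_field_def using inv by auto
qed

section \<open>Matching of subspaces and of bases\<close>

lemma is_basis_through:
  assumes "subspace_of_dim m V" "e \<in> V" "e \<noteq> 0"
  obtains a where "is_basis m a V" "a 0 = e"
proof -
  have V: "subspace V" "fin_dim V" "dim V = m"
    using subspace_of_dim_fin_dim[OF assms(1)] by simp_all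
  have "{e} \<subseteq> V" using assms(2) by simp
  moreover have "independent {e}" using assms(3) dependent_single by blast
  ultimately obtain D where D: "{e} \<subseteq> D" "finite D" "independent D" "span D = V" "card D = m"
    using V fin_dim_extend_basis[of V "{e}"] by metis
  have "card {0<..<m} = card (D - {e})" using D by simp
  then obtain f where f: "bij_betw f {0<..<m} (D - {e})"
    using finite_same_card_bij[OF finite_greaterThanLessThan finite_Diff[OF D(2)]] by blast
  have m: "m > 0" using D(1,2,5) by (auto simp: card_gt_0_iff)
  define a where "a = f(0 := e)"
  have "{..<m} = insert 0 {0<..<m}" using m by auto
  moreover have "a ` {0<..<m} = D - {e}"
    using bij_betw_imp_surj_on[OF f] by (simp add: a_def)
  moreover have "a 0 = e" by (simp add: a_def)
  ultimately have img: "a ` {..<m} = D" using D(1) by auto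
  then have "inj_on a {..<m}" using D(5) by (simp add: eq_card_imp_inj_on)
  then have "is_basis m a V" unfolding is_basis_def using img D by simp
  then show ?thesis using that \<open>a 0 = e\<close> by blast
qed

text \<open>A basis vector of \<open>A'\<close> lying in a subspace of \<open>A\<close> that is stable under \<open>C\<close> could not be matched
  to any element of \<open>C\<close>.\<close>

lemma rel_matched_dim_le:
  assumes "fin_dim A" "subspace A" "subspace S" "S \<subseteq> A"
    and "rel_matched A A' C"
    and stable: "\<And>s c. s \<in> S \<Longrightarrow> c \<in> C \<Longrightarrow> s * c \<in> S"
  shows "dim S + dim C \<le> dim A"
proof -
  obtain m where m: "m > 0" "A' \<subseteq> A" "subspace_of_dim m A'" "subspace_of_dim m C"
    "\<And>a. is_basis m a A' \<Longrightarrow> \<exists>b. is_basis m b C \<and> (\<forall>i<m. a i * b i \<notin> A)"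
    using assms(5) unfolding rel_matched_def by auto
  have A': "subspace A'" "dim A' = m" and C: "dim C = m"
    using subspace_of_dim_fin_dim[OF m(3)] subspace_of_dim_fin_dim[OF m(4)] by simp_all
  have "S \<inter> A' \<subseteq> {0}"
  proof
    fix e assume e: "e \<in> S \<inter> A'"
    show "e \<in> {0}"
    proof (rule ccontr)
      assume "e \<notin> {0}"
      \<comment> \<open>\<open>rel_matched\<close> ranges over all bases of \<open>A'\<close>, in
        particular over one that begins with \<open>e\<close>.\<close>
      then obtain a where a: "is_basis m a A'" "a 0 = e"
        using is_basis_through[OF m(3), of e] e by auto
      then obtain b where b: "is_basis m b C" "\<forall>i<m. a i * b i \<notin> A" using m(5) by blast
      have "b 0 \<in> span (b ` {..<m})" using m(1) by (intro span_base) simp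
      then have "b 0 \<in> C" using b(1) unfolding is_basis_def by simp
      then have "e * b 0 \<in> A" using stable[of e "b 0"] e assms(4) by blast
      then show False using a(2) b(2) m(1) by blast
    qed
  qed
  then have "dim (S \<inter> A') = 0" using dim_le_card[of "S \<inter> A'" "{}"] by simp
  \<comment> \<open>\<open>A'\<close> and \<open>C\<close> both have dimension \<open>m\<close>, so
    the bound for \<open>S\<close> and \<open>A'\<close> inside \<open>A\<close> is the one for
    \<open>S\<close> and \<open>C\<close>.\<close>
  then show ?thesis
    using fin_dim_dim_Int_ge[OF assms(1-4) A'(1) m(2)] A'(2) C by simp
qed

lemma locally_matched_dim_le:
  assumes A: "subspace_of_dim n A" and B: "subspace_of_dim n B" "1 \<notin> B"
    and "locally_matched A B"
    and S: "subspace S" "S \<subseteq> A" "S \<noteq> {0}" and U: "subspace U" "U \<subseteq> B"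
    and prod: "\<And>s u. s \<in> S \<Longrightarrow> u \<in> U \<Longrightarrow> s * u \<in> A"
  shows "dim S + dim U \<le> n"
proof -
  have A': "subspace A" "fin_dim A" "dim A = n" and B': "subspace B" "fin_dim B" "dim B = n"
    using subspace_of_dim_fin_dim[OF A] subspace_of_dim_fin_dim[OF B(1)] by simp_all
  have fU: "fin_dim U" by (rule fin_dim_subset[OF B'(2) U(2)])
  obtain T W where T: "subspace T" "S \<subseteq> T" "T \<subseteq> A" and W: "subspace W" "W \<subseteq> U"
    and dims: "dim T + dim W = dim S + dim U" and TW: "\<And>t w. t \<in> T \<Longrightarrow> w \<in> W \<Longrightarrow> t * w \<in> T"
    using dyson_transform[OF A'(2,1) S(1,2) U(1) fU prod] by blast
  have fT: "fin_dim T" by (rule fin_dim_subset[OF A'(2) T(3)])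
  define H where "H = {h. \<forall>s\<in>T. s * h \<in> T}"
  have H: "intermediate_field H" unfolding H_def using stabilizer_intermediate_field[OF fT T(1)] .
  have WH: "W \<subseteq> H \<inter> B" using W U TW unfolding H_def by blast
  have fHB: "fin_dim (H \<inter> B)" by (rule fin_dim_subset[OF B'(2) Int_lower2])
  have dW: "dim W \<le> dim (H \<inter> B)" using fin_dim_dim_mono[OF fHB WH] .
  \<comment> \<open>This \<open>t\<close> serves as the nonzero \<open>a \<in> A\<close> with
    \<open>a H \<subseteq> A\<close> in the definition of local matching, because
    \<open>t H \<subseteq> T \<subseteq> A\<close>.\<close>
  obtain t where t: "t \<in> T" "t \<noteq> 0" using S T subspace_0[OF S(1)] by blast
  \<comment> \<open>Otherwise \<open>T\<close>, hence \<open>A\<close>, is all of \<open>L\<close>;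
    comparing dimensions, so is \<open>B\<close>, against \<open>1 \<notin> B\<close>.\<close>
  have "H \<noteq> UNIV"
  proof
    assume "H = UNIV"
    then have "t * (inverse t * x) \<in> T" for x using t unfolding H_def by blast
    then have "T = UNIV" using t by (auto simp: mult.assoc[symmetric])
    then have "A = UNIV" using T by blast
    then have "B = UNIV" using fin_dim_subspace_eq[of A B] A' B' by simp
    then show False using B(2) by blast
  qed
  moreover have "t \<in> A" "(*) t ` H \<subseteq> A" using t T unfolding H_def by auto
  ultimately have local: "\<exists>A'. rel_matched A A' (H \<inter> B)" if "H \<inter> B \<noteq> {0}"
    using assms(4) H that t unfolding locally_matched_def by blast
  have "dim T + dim (H \<inter> B) \<le> n"
  \<comment> \<open>Local matching says nothing when \<open>H \<inter> B = {0}\<close>, but then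
    \<open>dim T \<le> dim A\<close> is already enough.\<close>
  proof (cases "H \<inter> B = {0}")
    case True
    then have "dim (H \<inter> B) = 0" using dim_le_card[of "H \<inter> B" "{}"] by simp
    then show ?thesis using fin_dim_dim_mono[OF A'(2) T(3)] A' by simp
  next
    case False
    then obtain A'' where "rel_matched A A'' (H \<inter> B)" using local by blast
    then show ?thesis
      using rel_matched_dim_le[OF A'(2,1) T(1,3)] A'(3) unfolding H_def by blast
  qed
  then show ?thesis using dims dW by linarith
qed

lemma locally_matched_imp_matched:
  assumes A: "subspace_of_dim n A" and B: "subspace_of_dim n B" "1 \<notin> B"
    and loc: "locally_matched A B"
  shows "matched A B"
  unfolding matched_def
proof (intro allI impI)
  fix m a assume a: "is_basis m a A"
  have A': "subspace A" "fin_dim A" "dim A = n" and B': "subspace B" "fin_dim B" "dim B = n"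
    using subspace_of_dim_fin_dim[OF A] subspace_of_dim_fin_dim[OF B(1)] by simp_all
  have inj: "inj_on a {..<m}" and indep: "independent (a ` {..<m})" and spn: "span (a ` {..<m}) = A"
    using a unfolding is_basis_def by auto
  \<comment> \<open>The definition of \<open>matched\<close> leaves the length of the basis open;
    the dimension of \<open>A\<close> fixes it.\<close>
  have "dim A = m"
    using dim_span_eq_card_independent[OF indep] card_image[OF inj] unfolding spn by simp
  then have mn: "m = n" using A' by simp
  \<comment> \<open>\<open>V i\<close> collects the vectors that \<open>basis_matched\<close>
    requires to lie in the span without \<open>b i\<close>, so the conclusion of
    \<open>dual_rado\<close> is the required matching.\<close>
  define V where "V i = {\<beta> \<in> B. a i * \<beta> \<in> A}" for i
  have V: "subspace (V i) \<and> V i \<subseteq> B" for i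
  proof (intro conjI subspaceI)
    show "0 \<in> V i" unfolding V_def using subspace_0 A' B' by simp
  next
    fix x y assume "x \<in> V i" "y \<in> V i"
    then show "x + y \<in> V i"
      unfolding V_def using subspace_add[OF B'(1)] subspace_add[OF A'(1)] by (simp add: distrib_left)
  next
    fix c x assume "x \<in> V i"
    then show "\<iota> c * x \<in> V i"
      unfolding V_def using subspace_scale[OF B'(1)] subspace_scale[OF A'(1), of "a i * x" c]
      by (simp add: mult.left_commute)
  qed (auto simp: V_def)
  have "rado_condition B n V"
    unfolding rado_condition_def
  proof (intro allI impI)
    fix J assume J: "J \<subseteq> {..<n}"
    let ?S = "span (a ` J)" and ?U = "B \<inter> \<Inter>(V ` J)"
    show "dim ?U + card J \<le> n"
    \<comment> \<open>For empty \<open>J\<close> the span \<open>?S\<close> is \<open>{0}\<close>,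
      which \<open>locally_matched_dim_le\<close> excludes; the claim is then just
      \<open>dim B \<le> n\<close>.\<close>
    proof (cases "J = {}")
      case True
      then show ?thesis using B' by simp
    next
      case False
      have indJ: "independent (a ` J)"
        by (rule independent_mono[OF indep[unfolded mn] image_mono[OF J]])
      have dS: "dim ?S = card J"
        using dim_span_eq_card_independent[OF indJ] card_image[OF inj_on_subset[OF inj[unfolded mn] J]]
        by simp
      have "?S \<noteq> {0}"
      proof
        assume "?S = {0}"
        then have "dim ?S = 0" using dim_le_card[of ?S "{}"] by simp
        moreover have "finite J" using finite_subset[OF J] by simp
        ultimately show False using dS False by simp
      qed
      moreover have "?S \<subseteq> A" using span_mono[OF image_mono[OF J, of a]] spn unfolding mn by simp
      moreover have U: "subspace ?U" using V B' by (intro subspace_Int_Inter) auto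
      moreover have "s * u \<in> A" if s: "s \<in> ?S" and u: "u \<in> ?U" for s u
      proof -
        \<comment> \<open>Membership in \<open>?U\<close> controls only products with the vectors
          \<open>a i\<close>; as this set is a subspace, the control extends to their span.\<close>
        have "subspace {x. x * u \<in> A}"
        proof (rule subspaceI)
          show "0 \<in> {x. x * u \<in> A}" using subspace_0[OF A'(1)] by simp
        next
          fix x y assume "x \<in> {x. x * u \<in> A}" "y \<in> {x. x * u \<in> A}"
          then show "x + y \<in> {x. x * u \<in> A}"
            using subspace_add[OF A'(1)] by (simp add: distrib_right)
        next
          fix c x assume "x \<in> {x. x * u \<in> A}"
          then show "\<iota> c * x \<in> {x. x * u \<in> A}"
            using subspace_scale[OF A'(1), of "x * u" c] by (simp add: mult.assoc)
        qed
        then have "?S \<subseteq> {x. x * u \<in> A}"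
          using u unfolding V_def by (intro span_minimal) auto
        then show ?thesis using s by blast
      qed
      ultimately have "dim ?S + dim ?U \<le> n"
        using locally_matched_dim_le[OF A B loc, of ?S ?U] by simp
      then show ?thesis using dS by simp
    qed
  qed
  from dual_rado[OF B'(2,1,3) V this] obtain b where b: "inj_on b {..<n}"
    "independent (b ` {..<n})" "span (b ` {..<n}) = B"
    "\<forall>i<n. V i \<subseteq> span (b ` {..<n} - {b i})"
    by blast
  then have "is_basis m b B \<and> basis_matched m A B a b"
    unfolding is_basis_def basis_matched_def V_def mn by blast
  then show "\<exists>b. is_basis m b B \<and> basis_matched m A B a b" by blast
qed

end

theorem theorem5p1:
  fixes \<iota> :: "'k::field \<Rightarrow> 'l::field" and A B :: "'l set" and n :: nat
  assumes "field_extension \<iota>"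
    and "\<And>x. field_extension.algebraic_over \<iota> x \<Longrightarrow> field_extension.separable_over \<iota> x"
    and "field_extension.subspace_of_dim \<iota> n A" and "A \<noteq> {0}"
    and "field_extension.subspace_of_dim \<iota> n B" and "B \<noteq> {0}"
    and "1 \<notin> B"
    and "field_extension.locally_matched \<iota> A B"
  shows "field_extension.matched \<iota> A B"
  using field_extension.locally_matched_imp_matched[OF assms(1,3,5,7,8)] .

end
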